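(* Suppose the matrix $A(t)=A(t;\boldsymbol\theta)\in\mathbb{R}^{2N\times 2N}$ has the structure $$A(t)=A_d+\sum_{j=1}^{N_C}c_j(t)A_{c,j},\qquad c_j(t)=\sum_{k=1}^{n_j}\theta_{j,k}\,c_{j,k}(t),\qquad \sum_{j=1}^{N_C}n_j=N_P,$$ where $A_d,A_{c,1},\dots,A_{c,N_C}$ are constant matrices, the $c_{j,k}$ are given (sufficiently smooth) scalar functions of $t$, and $\boldsymbol\theta=(\theta_{j,k})\in\mathbb{R}^{N_P}$ is the vector of control parameters, also indexed as $\theta_1,\dots,\theta_{N_P}$. Then the gradient accumulation $$\frac{d\mathcal{J}}{d\theta_k}=-\sum_{n=0}^{N_T-1}\left\langle\frac{\partial L_{n+1,q}}{\partial\theta_k}\mathbf{w}_{n+1}+\frac{\partial R_{n,p}}{\partial\theta_k}\mathbf{w}_n,\ \boldsymbol\lambda_{n+1}\right\rangle,\qquad k=1,\dots,N_P,$$ i.e. the computation of the right-hand sides for all $k=1,\dots,N_P$ from given vectors $\mathbf{w}_0,\dots,\mathbf{w}_{N_T},\boldsymbol\lambda_1,\dots,\boldsymbol\lambda_{N_T}\in\mathbb{R}^{2N}$, can be rewritten so that the total number of matrix-vector multiplications required is independent of the number of control parameters $N_P$. That is, for fixed $N,N_T,N_C,p,q$ there is a number $M$, not depending on $N_P$, such that all $N_P$ values can be computed using at most $M$ matrix-vector multiplications.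
   Context: Setting. $N,N_C,N_P,N_T\ge1$ are integers, $T>0$, $\Delta t=T/N_T$, $t_n=n\Delta t$. The system is $\frac{d}{dt}\mathbf{w}=A(t;\boldsymbol\theta)\mathbf{w}$ on $\mathbb{R}^{2N}$ (the real form of Schrödinger's equation on $\mathbb{C}^N$). $N_C$ is the number of control pulses $c_j(t)$ and $N_P$ the total number of control parameters. Hermite Runge-Kutta matrices. Fix nonnegative integers $p,q$ with $p+q\ge1$. Write $A_n^{(j)}=\frac{d^jA}{dt^j}(t_n;\boldsymbol\theta)$. Define $$D_{n,0}=I,\qquad D_{n,j+1}=\sum_{i=0}^{j}\binom{j}{i}A_n^{(j-i)}D_{n,i},$$ $$c_j^{pq}=\binom{p}{j}\Big/\binom{p+q}{j},\qquad c_j^{qp}=\binom{q}{j}\Big/\binom{p+q}{j},$$ $$L_{n,q}=-\sum_{j=1}^{q}(-1)^jc_j^{qp}\frac{1}{j!}\Delta t^jD_{n,j},\qquad R_{n,p}=\sum_{j=1}^{p}c_j^{pq}\frac{1}{j!}\Delta t^jD_{n,j}.$$ (The doubly superscripted numbers $c_j^{pq}$ are method coefficients, unrelated to the control pulses $c_j(t)$.) The derivatives $\partial L_{n,q}/\partial\theta_k$, $\partial R_{n,p}/\partial\theta_k$ are entrywise, and $\langle\cdot,\cdot\rangle$ is the Euclidean dot product. Cost convention. A matrix-vector multiplication is the product of one of the $2N\times 2N$ matrices $A_n^{(i)}$, $\partial A_n^{(i)}/\partial\theta_k$, $A_d$, $A_{c,j}$, or the transpose of one of these, with a vector in $\mathbb{R}^{2N}$.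 Only these are counted; inner products and linear combinations of vectors, scalar arithmetic, and evaluations of the control functions, their time derivatives, and the derivatives of these with respect to the control parameters (such as $\partial c_j^{(i)}(t_n)/\partial\theta_k$, where $c_j^{(i)}=d^ic_j/dt^i$) are not counted. Role of the vectors. In the application, $\mathbf{w}_n$ are the states of the Hermite Runge-Kutta scheme $\mathbf{w}_{n+1}-L_{n+1,q}\mathbf{w}_{n+1}=\mathbf{w}_n+R_{n,p}\mathbf{w}_n$, $\mathcal{J}$ is a discrete objective function $\sum_{n=0}^{N_T}\mathfrak{j}_n(\mathbf{w}_n)$, and $\boldsymbol\lambda_n$ are the adjoint vectors for which the displayed formula gives $d\mathcal{J}/d\theta_k$; for the present statement the $\mathbf{w}_n$ and $\boldsymbol\lambda_n$ are simply given. *)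

theory Defs
  imports "HOL-Analysis.Analysis"
begin

text \<open>
  Time derivatives are taken within \<^term>\<open>{0..T}\<close>, hence are one-sided at the two end points,
  so that the functions involved only matter on the time interval.
\<close>

fun time_deriv :: "real \<Rightarrow> nat \<Rightarrow> (real \<Rightarrow> 'a::real_normed_vector) \<Rightarrow> real \<Rightarrow> 'a" where
  "time_deriv T 0 f = f"
| "time_deriv T (Suc i) f = (\<lambda>t. vector_derivative (time_deriv T i f) (at t within {0..T}))"

definition times_differentiable :: "real \<Rightarrow> nat \<Rightarrow> (real \<Rightarrow> real) \<Rightarrow> bool" where
  "times_differentiable T m f \<longleftrightarrow>
     (\<forall>i<m. \<forall>t\<in>{0..T}. time_deriv T i f differentiable (at t within {0..T}))"

definition time_step :: "real \<Rightarrow> nat \<Rightarrow> real" where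
  "time_step T NT = T / real NT"

definition grid_time :: "real \<Rightarrow> nat \<Rightarrow> nat \<Rightarrow> real" where
  "grid_time T NT n = real n * time_step T NT"

definition scalar_pderiv :: "(('k \<Rightarrow> real) \<Rightarrow> real) \<Rightarrow> ('k \<Rightarrow> real) \<Rightarrow> 'k \<Rightarrow> real" where
  "scalar_pderiv f \<theta> k = deriv (\<lambda>x. f (\<theta>(k := x))) (\<theta> k)"

definition matrix_pderiv ::
  "(('k \<Rightarrow> real) \<Rightarrow> real^'m^'m) \<Rightarrow> ('k \<Rightarrow> real) \<Rightarrow> 'k \<Rightarrow> real^'m^'m" where
  "matrix_pderiv F \<theta> k = (\<chi> r s. scalar_pderiv (\<lambda>\<theta>'. F \<theta>' $ r $ s) \<theta> k)"


section \<open>Hermite Runge-Kutta matrices\<close>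

fun hrk_D :: "real \<Rightarrow> (real \<Rightarrow> real^'m^'m) \<Rightarrow> real \<Rightarrow> nat \<Rightarrow> real^'m^'m" where
  "hrk_D T A t 0 = mat 1"
| "hrk_D T A t (Suc j) =
     (\<Sum>i\<le>j. real (j choose i) *\<^sub>R (time_deriv T (j - i) A t ** hrk_D T A t i))"

definition hrk_coeff :: "nat \<Rightarrow> nat \<Rightarrow> nat \<Rightarrow> real" where
  "hrk_coeff p q j = real (p choose j) / real ((p + q) choose j)"

definition hrk_L ::
  "nat \<Rightarrow> nat \<Rightarrow> real \<Rightarrow> nat \<Rightarrow> (real \<Rightarrow> real^'m^'m) \<Rightarrow> nat \<Rightarrow> real^'m^'m" where
  "hrk_L p q T NT A n =
     - (\<Sum>j=1..q. ((-1) ^ j * hrk_coeff q p j * (1 / fact j) * time_step T NT ^ j) *\<^sub>R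
          hrk_D T A (grid_time T NT n) j)"

definition hrk_R ::
  "nat \<Rightarrow> nat \<Rightarrow> real \<Rightarrow> nat \<Rightarrow> (real \<Rightarrow> real^'m^'m) \<Rightarrow> nat \<Rightarrow> real^'m^'m" where
  "hrk_R p q T NT A n =
     (\<Sum>j=1..p. (hrk_coeff p q j * (1 / fact j) * time_step T NT ^ j) *\<^sub>R
          hrk_D T A (grid_time T NT n) j)"

definition gradient_accumulation ::
  "nat \<Rightarrow> nat \<Rightarrow> real \<Rightarrow> nat \<Rightarrow> (('k \<Rightarrow> real) \<Rightarrow> real \<Rightarrow> real^'m^'m) \<Rightarrow> ('k \<Rightarrow> real) \<Rightarrow>
     (nat \<Rightarrow> real^'m) \<Rightarrow> (nat \<Rightarrow> real^'m) \<Rightarrow> 'k \<Rightarrow> real" where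
  "gradient_accumulation p q T NT A \<theta> w lam k =
     - (\<Sum>n=0..NT - 1.
          (matrix_pderiv (\<lambda>\<theta>'. hrk_L p q T NT (A \<theta>') (n + 1)) \<theta> k *v w (n + 1)
           + matrix_pderiv (\<lambda>\<theta>'. hrk_R p q T NT (A \<theta>') n) \<theta> k *v w n) \<bullet> lam (n + 1))"


section \<open>Control systems\<close>

text \<open>
  Pulse \<open>j\<close> has \<open>nj j\<close> parameters; the parameter vector is indexed by the pairs \<open>(j, k)\<close> with
  \<open>1 \<le> j \<le> NC\<close> and \<open>1 \<le> k \<le> nj j\<close>, and no other argument of \<open>\<theta>\<close> is used.
\<close>

definition control_pulse ::
  "(nat \<Rightarrow> nat) \<Rightarrow> (nat \<Rightarrow> nat \<Rightarrow> real \<Rightarrow> real) \<Rightarrow> (nat \<times> nat \<Rightarrow> real) \<Rightarrow> nat \<Rightarrow> real \<Rightarrow> real" where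
  "control_pulse nj c \<theta> j t = (\<Sum>k=1..nj j. \<theta> (j, k) * c j k t)"

definition system_matrix ::
  "nat \<Rightarrow> (nat \<Rightarrow> nat) \<Rightarrow> real^'m^'m \<Rightarrow> (nat \<Rightarrow> real^'m^'m) \<Rightarrow> (nat \<Rightarrow> nat \<Rightarrow> real \<Rightarrow> real) \<Rightarrow>
     (nat \<times> nat \<Rightarrow> real) \<Rightarrow> real \<Rightarrow> real^'m^'m" where
  "system_matrix NC nj Ad Ac c \<theta> t = Ad + (\<Sum>j=1..NC. control_pulse nj c \<theta> j t *\<^sub>R Ac j)"


section \<open>Straight-line programs and their cost\<close>

text \<open>
  A program is a list of instructions acting on scalar and vector registers, all of which
  initially hold zero.  The first argument of an instruction is its target register.  Matrices are
  accessible only through products with vectors, and the only vectors a program can read are the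
  given \<open>w\<^sub>n\<close> and \<open>\<lambda>\<^sub>n\<close>; in particular neither matrix entries nor unit vectors are available.

  The natural numbers in the names of input quantities are to be read as follows:
  \<open>Sys_Deriv i n\<close> is the \<open>i\<close>-th time derivative of the system matrix at time \<open>t\<^sub>n\<close>,
  \<open>Sys_Param_Deriv i n k\<close> its partial derivative with respect to \<open>\<theta>\<^sub>k\<close>,
  \<open>Load_Pulse d j i n\<close> reads the \<open>i\<close>-th time derivative of pulse \<open>j\<close> at \<open>t\<^sub>n\<close>,
  and \<open>Load_Pulse_Deriv d j i n k\<close> its partial derivative with respect to \<open>\<theta>\<^sub>k\<close>.
  Here \<open>k\<close> is the flat parameter index in \<open>{1..NP}\<close>.
\<close>

datatype matrix_ref =
    Drift
  | Control nat
  | Sys_Deriv nat nat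
  | Sys_Param_Deriv nat nat nat

datatype instr =
    Load_Const nat real
  | Load_Step nat
  | Load_Param nat nat
  | Load_Pulse nat nat nat nat
  | Load_Pulse_Deriv nat nat nat nat nat
  | Scalar_Add nat nat nat
  | Scalar_Diff nat nat nat
  | Scalar_Mult nat nat nat
  | Scalar_Div nat nat nat
  | Inner_Prod nat nat nat
  | Load_State nat nat
  | Load_Adjoint nat nat
  | Vec_Add nat nat nat
  | Vec_Scale nat nat nat
  | Mat_Vec nat matrix_ref nat
  | Mat_Transpose_Vec nat matrix_ref nat

record ('m::finite) inputs =
  in_step :: real
  in_param :: "nat \<Rightarrow> real"
  in_pulse :: "nat \<Rightarrow> nat \<Rightarrow> nat \<Rightarrow> real"
  in_pulse_deriv :: "nat \<Rightarrow> nat \<Rightarrow> nat \<Rightarrow> nat \<Rightarrow> real"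
  in_matrix :: "matrix_ref \<Rightarrow> real^'m^'m"
  in_state :: "nat \<Rightarrow> real^'m"
  in_adjoint :: "nat \<Rightarrow> real^'m"

fun exec_instr ::
  "('m::finite) inputs \<Rightarrow> instr \<Rightarrow> (nat \<Rightarrow> real) \<times> (nat \<Rightarrow> real^'m) \<Rightarrow>
     (nat \<Rightarrow> real) \<times> (nat \<Rightarrow> real^'m)" where
  "exec_instr D (Load_Const d r) (s, v) = (s(d := r), v)"
| "exec_instr D (Load_Step d) (s, v) = (s(d := in_step D), v)"
| "exec_instr D (Load_Param d k) (s, v) = (s(d := in_param D k), v)"
| "exec_instr D (Load_Pulse d j i n) (s, v) = (s(d := in_pulse D j i n), v)"
| "exec_instr D (Load_Pulse_Deriv d j i n k) (s, v) = (s(d := in_pulse_deriv D j i n k), v)"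
| "exec_instr D (Scalar_Add d a b) (s, v) = (s(d := s a + s b), v)"
| "exec_instr D (Scalar_Diff d a b) (s, v) = (s(d := s a - s b), v)"
| "exec_instr D (Scalar_Mult d a b) (s, v) = (s(d := s a * s b), v)"
| "exec_instr D (Scalar_Div d a b) (s, v) = (s(d := s a / s b), v)"
| "exec_instr D (Inner_Prod d x y) (s, v) = (s(d := v x \<bullet> v y), v)"
| "exec_instr D (Load_State d n) (s, v) = (s, v(d := in_state D n))"
| "exec_instr D (Load_Adjoint d n) (s, v) = (s, v(d := in_adjoint D n))"
| "exec_instr D (Vec_Add d x y) (s, v) = (s, v(d := v x + v y))"
| "exec_instr D (Vec_Scale d a x) (s, v) = (s, v(d := s a *\<^sub>R v x))"
| "exec_instr D (Mat_Vec d X x) (s, v) = (s, v(d := in_matrix D X *v v x))"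
| "exec_instr D (Mat_Transpose_Vec d X x) (s, v) =
     (s, v(d := transpose (in_matrix D X) *v v x))"

definition run :: "('m::finite) inputs \<Rightarrow> instr list \<Rightarrow> (nat \<Rightarrow> real) \<times> (nat \<Rightarrow> real^'m)" where
  "run D P = fold (exec_instr D) P (\<lambda>_. 0, \<lambda>_. 0)"

text \<open>The \<open>k\<close>-th output of a program is the final content of scalar register \<open>k\<close>.\<close>

definition program_output :: "('m::finite) inputs \<Rightarrow> instr list \<Rightarrow> nat \<Rightarrow> real" where
  "program_output D P k = fst (run D P) k"

fun is_matvec :: "instr \<Rightarrow> bool" where
  "is_matvec (Mat_Vec d X x) = True"
| "is_matvec (Mat_Transpose_Vec d X x) = True"
| "is_matvec _ = False"

definition matvec_count :: "instr list \<Rightarrow> nat" where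
  "matvec_count P = length (filter is_matvec P)"

text \<open>
  Programs may only refer to quantities that are part of the input.  The matrices \<open>D\<^sub>n\<^sub>,\<^sub>j\<close> with
  \<open>j \<le> max p q\<close> involve time derivatives of order less than \<open>max p q\<close> only.
\<close>

fun valid_matrix_ref :: "nat \<Rightarrow> nat \<Rightarrow> nat \<Rightarrow> nat \<Rightarrow> nat \<Rightarrow> matrix_ref \<Rightarrow> bool" where
  "valid_matrix_ref p q NT NC NP Drift \<longleftrightarrow> True"
| "valid_matrix_ref p q NT NC NP (Control j) \<longleftrightarrow> j \<in> {1..NC}"
| "valid_matrix_ref p q NT NC NP (Sys_Deriv i n) \<longleftrightarrow> i < max p q \<and> n \<le> NT"
| "valid_matrix_ref p q NT NC NP (Sys_Param_Deriv i n k) \<longleftrightarrow>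
     i < max p q \<and> n \<le> NT \<and> k \<in> {1..NP}"

fun valid_instr :: "nat \<Rightarrow> nat \<Rightarrow> nat \<Rightarrow> nat \<Rightarrow> nat \<Rightarrow> instr \<Rightarrow> bool" where
  "valid_instr p q NT NC NP (Load_Param d k) \<longleftrightarrow> k \<in> {1..NP}"
| "valid_instr p q NT NC NP (Load_Pulse d j i n) \<longleftrightarrow> j \<in> {1..NC} \<and> i < max p q \<and> n \<le> NT"
| "valid_instr p q NT NC NP (Load_Pulse_Deriv d j i n k) \<longleftrightarrow>
     j \<in> {1..NC} \<and> i < max p q \<and> n \<le> NT \<and> k \<in> {1..NP}"
| "valid_instr p q NT NC NP (Load_State d n) \<longleftrightarrow> n \<le> NT"
| "valid_instr p q NT NC NP (Load_Adjoint d n) \<longleftrightarrow> n \<in> {1..NT}"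
| "valid_instr p q NT NC NP (Mat_Vec d X x) \<longleftrightarrow> valid_matrix_ref p q NT NC NP X"
| "valid_instr p q NT NC NP (Mat_Transpose_Vec d X x) \<longleftrightarrow> valid_matrix_ref p q NT NC NP X"
| "valid_instr p q NT NC NP _ \<longleftrightarrow> True"

definition valid_program :: "nat \<Rightarrow> nat \<Rightarrow> nat \<Rightarrow> nat \<Rightarrow> nat \<Rightarrow> instr list \<Rightarrow> bool" where
  "valid_program p q NT NC NP P \<longleftrightarrow> (\<forall>I\<in>set P. valid_instr p q NT NC NP I)"

text \<open>Here \<open>e\<close> maps a flat parameter index to the corresponding pair \<open>(j, k)\<close>.\<close>

fun control_matrix ::
  "real \<Rightarrow> nat \<Rightarrow> nat \<Rightarrow> (nat \<Rightarrow> nat) \<Rightarrow> (nat \<Rightarrow> nat \<times> nat) \<Rightarrow> real^'m^'m \<Rightarrow> (nat \<Rightarrow> real^'m^'m) \<Rightarrow>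
     (nat \<Rightarrow> nat \<Rightarrow> real \<Rightarrow> real) \<Rightarrow> (nat \<times> nat \<Rightarrow> real) \<Rightarrow> matrix_ref \<Rightarrow> real^'m^'m" where
  "control_matrix T NT NC nj e Ad Ac c \<theta> Drift = Ad"
| "control_matrix T NT NC nj e Ad Ac c \<theta> (Control j) = Ac j"
| "control_matrix T NT NC nj e Ad Ac c \<theta> (Sys_Deriv i n) =
     time_deriv T i (system_matrix NC nj Ad Ac c \<theta>) (grid_time T NT n)"
| "control_matrix T NT NC nj e Ad Ac c \<theta> (Sys_Param_Deriv i n k) =
     matrix_pderiv (\<lambda>\<theta>'. time_deriv T i (system_matrix NC nj Ad Ac c \<theta>') (grid_time T NT n))
       \<theta> (e k)"

definition control_inputs ::
  "real \<Rightarrow> nat \<Rightarrow> nat \<Rightarrow> (nat \<Rightarrow> nat) \<Rightarrow> (nat \<Rightarrow> nat \<times> nat) \<Rightarrow> real^'m^'m \<Rightarrow> (nat \<Rightarrow> real^'m^'m) \<Rightarrow>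
     (nat \<Rightarrow> nat \<Rightarrow> real \<Rightarrow> real) \<Rightarrow> (nat \<times> nat \<Rightarrow> real) \<Rightarrow> (nat \<Rightarrow> real^'m) \<Rightarrow> (nat \<Rightarrow> real^'m) \<Rightarrow>
     ('m::finite) inputs" where
  "control_inputs T NT NC nj e Ad Ac c \<theta> w lam =
     \<lparr> in_step = time_step T NT,
       in_param = (\<lambda>k. \<theta> (e k)),
       in_pulse = (\<lambda>j i n. time_deriv T i (control_pulse nj c \<theta> j) (grid_time T NT n)),
       in_pulse_deriv = (\<lambda>j i n k.
         scalar_pderiv (\<lambda>\<theta>'. time_deriv T i (control_pulse nj c \<theta>' j) (grid_time T NT n)) \<theta> (e k)),
       in_matrix = control_matrix T NT NC nj e Ad Ac c \<theta>,
       in_state = w,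
       in_adjoint = lam \<rparr>"

end

theory Submission
  imports Defs
begin

text \<open>
  The system matrix is affine in \<open>\<theta>\<close>, and the partial derivative of its \<open>i\<close>-th time derivative with
  respect to \<open>\<theta>\<^sub>k\<close> is a combination of the control matrices \<open>A\<^sub>c\<^sub>,\<^sub>j\<close> whose coefficients are the free
  scalars \<open>g = \<partial>c\<^sub>j\<^sup>(\<^sup>i\<^sup>)(t\<^sub>n)/\<partial>\<theta>\<^sub>k\<close>.  Differentiating the recursion for \<open>D\<^sub>n\<^sub>,\<^sub>m\<close> shows that
  \<open>(\<partial>D\<^sub>n\<^sub>,\<^sub>m/\<partial>\<theta>\<^sub>k) w\<close> is linear in these scalars: it equals \<open>\<Sum>\<^sub>j\<^sub>,\<^sub>i g V\<close> with vectors \<open>V\<close> depending on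
  \<open>n\<close>, \<open>m\<close>, \<open>j\<close>, \<open>i\<close> but not on \<open>k\<close>.  All matrix-vector products are spent on the \<open>V\<close>; a further
  parameter only costs additional inner products and scalar operations.
\<close>

section \<open>Time derivatives and parameter derivatives of the system matrix\<close>

text \<open>Time differentiation passes to the scalar coefficients and removes the constant
  \<open>B\<close> after the first step. The normed-space generality lets one induction serve the
  real-valued pulses and the matrix-valued system alike.\<close>

lemma time_deriv_affine:
  fixes B :: "'a::real_normed_vector" and V :: "'k \<Rightarrow> 'a" and f :: "'k \<Rightarrow> real \<Rightarrow> real"
  assumes T: "T > 0" and diff: "\<And>k. k \<in> K \<Longrightarrow> times_differentiable T m (f k)"
    and "i \<le> m" "t \<in> {0..T}"
  shows "time_deriv T i (\<lambda>t. B + (\<Sum>k\<in>K. f k t *\<^sub>R V k)) t =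
    (if i = 0 then B else 0) + (\<Sum>k\<in>K. time_deriv T i (f k) t *\<^sub>R V k)"
  using assms(3,4)
proof (induction i arbitrary: t)
  case 0
  then show ?case by simp
next
  case (Suc i)
  let ?F = "\<lambda>t. (if i = 0 then B else 0) + (\<Sum>k\<in>K. time_deriv T i (f k) t *\<^sub>R V k)"
  have "((\<lambda>t. time_deriv T i (f k) t) has_vector_derivative time_deriv T (Suc i) (f k) t)
      (at t within {0..T})" if "k \<in> K" for k
    using diff[OF that] Suc.prems by (auto simp: times_differentiable_def vector_derivative_works)
  then have "(?F has_vector_derivative
      0 + (\<Sum>k\<in>K. time_deriv T i (f k) t *\<^sub>R 0 + time_deriv T (Suc i) (f k) t *\<^sub>R V k))
      (at t within {0..T})"
    by (intro has_vector_derivative_add has_vector_derivative_const has_vector_derivative_sum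
        has_vector_derivative_scaleR)
      (auto simp: has_real_derivative_iff_has_vector_derivative)
  \<comment> \<open>The induction hypothesis is an identity on \<open>{0..T}\<close> only; this is
    enough to transfer a derivative taken within that interval.\<close>
  then have "(time_deriv T i (\<lambda>t. B + (\<Sum>k\<in>K. f k t *\<^sub>R V k)) has_vector_derivative
      (\<Sum>k\<in>K. time_deriv T (Suc i) (f k) t *\<^sub>R V k)) (at t within {0..T})"
    using has_vector_derivative_transform[OF Suc.prems(2) Suc.IH] Suc.prems(1) by simp
  \<comment> \<open>\<open>vector_derivative\<close> selects a derivative by choice; it is
    determined because \<open>T > 0\<close> makes the interval nondegenerate.\<close>
  from vector_derivative_within_cbox[unfolded box_real, OF T Suc.prems(2) this] show ?case by simp
qed

lemma matrix_pderiv_eqI: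
  assumes "\<And>r s. ((\<lambda>x. F (\<theta>(k := x)) $ r $ s) has_real_derivative F' $ r $ s) (at (\<theta> k))"
  shows "matrix_pderiv F \<theta> k = F'"
  using assms by (simp add: matrix_pderiv_def scalar_pderiv_def vec_eq_iff DERIV_imp_deriv)

lemma control_pulse_time_deriv:
  assumes "T > 0" "\<And>k. k \<in> {1..nj j} \<Longrightarrow> times_differentiable T m (c j k)" "i \<le> m" "t \<in> {0..T}"
  shows "time_deriv T i (control_pulse nj c \<theta> j) t =
    (\<Sum>k=1..nj j. \<theta> (j, k) * time_deriv T i (c j k) t)"
  using time_deriv_affine[of T "{1..nj j}" m "c j" i t 0 "\<lambda>k. \<theta> (j, k)"] assms
  by (simp add: control_pulse_def[abs_def] mult.commute)

lemma system_matrix_time_deriv: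
  fixes Ad :: "real^'m^'m"
  assumes "T > 0" "i \<le> m" "t \<in> {0..T}"
    and "\<And>j k. j \<in> {1..NC} \<Longrightarrow> k \<in> {1..nj j} \<Longrightarrow> times_differentiable T m (c j k)"
  shows "time_deriv T i (system_matrix NC nj Ad Ac c \<theta>) t =
    (if i = 0 then Ad else 0) + (\<Sum>j=1..NC. time_deriv T i (control_pulse nj c \<theta> j) t *\<^sub>R Ac j)"
proof -
  \<comment> \<open>The double sum over pulses and their parameters is flattened to a sum over
    pairs, so that \<open>time_deriv_affine\<close> applies with the basis functions
    \<open>c j k\<close> as coefficients; afterwards it is regrouped by pulse.\<close>
  let ?S = "SIGMA j:{1..NC}. {1..nj j}"
  let ?f = "\<lambda>jk. c (fst jk) (snd jk)" and ?V = "\<lambda>jk. \<theta> jk *\<^sub>R Ac (fst jk)"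
  have "system_matrix NC nj Ad Ac c \<theta> = (\<lambda>t. Ad + (\<Sum>jk\<in>?S. ?f jk t *\<^sub>R ?V jk))"
    by (rule ext)
      (simp add: system_matrix_def control_pulse_def scaleR_sum_left sum.Sigma case_prod_unfold mult.commute)
  moreover have "time_deriv T i (\<lambda>t. Ad + (\<Sum>jk\<in>?S. ?f jk t *\<^sub>R ?V jk)) t =
      (if i = 0 then Ad else 0) + (\<Sum>jk\<in>?S. time_deriv T i (?f jk) t *\<^sub>R ?V jk)"
    using assms by (intro time_deriv_affine[where m = m]) auto
  moreover have "(\<Sum>jk\<in>?S. time_deriv T i (?f jk) t *\<^sub>R ?V jk) =
      (\<Sum>j=1..NC. \<Sum>k=1..nj j. time_deriv T i (c j k) t *\<^sub>R \<theta> (j, k) *\<^sub>R Ac j)"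
    by (simp add: sum.Sigma case_prod_unfold)
  moreover have "\<dots> = (\<Sum>j=1..NC. time_deriv T i (control_pulse nj c \<theta> j) t *\<^sub>R Ac j)"
  proof (intro sum.cong refl)
    fix j assume "j \<in> {1..NC}"
    then have "time_deriv T i (control_pulse nj c \<theta> j) t =
        (\<Sum>k=1..nj j. \<theta> (j, k) * time_deriv T i (c j k) t)"
      using assms by (intro control_pulse_time_deriv[where m = m])
    then show "(\<Sum>k=1..nj j. time_deriv T i (c j k) t *\<^sub>R \<theta> (j, k) *\<^sub>R Ac j) =
        time_deriv T i (control_pulse nj c \<theta> j) t *\<^sub>R Ac j"
      by (simp add: scaleR_sum_left mult.commute)
  qed
  ultimately show ?thesis by simp
qed

text \<open>The drift is constant in the parameters, so only the control matrices survive. Their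
  coefficients are left as \<open>scalar_pderiv\<close> because these are exactly the values that a
  program can load for free.\<close>

lemma system_matrix_param_deriv:
  fixes Ad :: "real^'m^'m"
  assumes "T > 0" "i \<le> m" "t \<in> {0..T}"
    and c: "\<And>j k. j \<in> {1..NC} \<Longrightarrow> k \<in> {1..nj j} \<Longrightarrow> times_differentiable T m (c j k)"
  shows "((\<lambda>x. time_deriv T i (system_matrix NC nj Ad Ac c (\<theta>(\<kappa> := x))) t $ r $ s) has_real_derivative
    (\<Sum>j=1..NC. scalar_pderiv (\<lambda>\<theta>'. time_deriv T i (control_pulse nj c \<theta>' j) t) \<theta> \<kappa> *\<^sub>R Ac j) $ r $ s)
    (at (\<theta> \<kappa>))"
proof -
  have "((\<lambda>x. time_deriv T i (control_pulse nj c (\<theta>(\<kappa> := x)) j) t) has_real_derivative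
      scalar_pderiv (\<lambda>\<theta>'. time_deriv T i (control_pulse nj c \<theta>' j) t) \<theta> \<kappa>) (at (\<theta> \<kappa>))"
    if j: "j \<in> {1..NC}" for j
  proof -
    have "((\<lambda>x. (\<theta>(\<kappa> := x)) (j, k)) has_real_derivative (if \<kappa> = (j, k) then 1 else 0)) (at (\<theta> \<kappa>))" for k
      by auto
    then have "((\<lambda>x. \<Sum>k=1..nj j. (\<theta>(\<kappa> := x)) (j, k) * time_deriv T i (c j k) t) has_real_derivative
        (\<Sum>k=1..nj j. (if \<kappa> = (j, k) then 1 else 0) * time_deriv T i (c j k) t)) (at (\<theta> \<kappa>))"
      by (intro DERIV_sum DERIV_cmult_right)
    \<comment> \<open>Existence suffices: \<open>scalar_pderiv\<close> is defined by
      \<open>deriv\<close>, which equals any derivative that exists.\<close>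
    then have "\<exists>y. ((\<lambda>x. time_deriv T i (control_pulse nj c (\<theta>(\<kappa> := x)) j) t) has_real_derivative y) (at (\<theta> \<kappa>))"
      using assms j by (subst control_pulse_time_deriv[where m = m]) auto
    then show ?thesis
      by (auto simp: scalar_pderiv_def DERIV_imp_deriv)
  qed
  then have "((\<lambda>x. (if i = 0 then Ad else 0) $ r $ s + (\<Sum>j=1..NC.
        time_deriv T i (control_pulse nj c (\<theta>(\<kappa> := x)) j) t * Ac j $ r $ s)) has_real_derivative
      0 + (\<Sum>j=1..NC. scalar_pderiv (\<lambda>\<theta>'. time_deriv T i (control_pulse nj c \<theta>' j) t) \<theta> \<kappa> * Ac j $ r $ s))
    (at (\<theta> \<kappa>))"
    by (intro DERIV_add DERIV_sum DERIV_cmult_right DERIV_const)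
  moreover have "time_deriv T i (system_matrix NC nj Ad Ac c \<theta>') t = (if i = 0 then Ad else 0) +
      (\<Sum>j=1..NC. time_deriv T i (control_pulse nj c \<theta>' j) t *\<^sub>R Ac j)" for \<theta>'
    using assms by (intro system_matrix_time_deriv[where m = m])
  ultimately show ?thesis by simp
qed

section \<open>Derivatives of the Hermite Runge-Kutta matrices\<close>

text \<open>The product rule applied to the recursion of \<open>hrk_D\<close>, with
  \<open>B i\<close> in place of the derivative of the \<open>i\<close>-th time derivative of
  \<open>A\<close>.\<close>

fun hrk_D_variation ::
  "real \<Rightarrow> (real \<Rightarrow> real^'m^'m) \<Rightarrow> real \<Rightarrow> (nat \<Rightarrow> real^'m^'m) \<Rightarrow> nat \<Rightarrow> real^'m^'m" where
  "hrk_D_variation T A t B 0 = 0"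
| "hrk_D_variation T A t B (Suc j) = (\<Sum>l\<le>j. real (j choose l) *\<^sub>R
     (B (j - l) ** hrk_D T A t l + time_deriv T (j - l) A t ** hrk_D_variation T A t B l))"

text \<open>The recursion for index \<open>j\<close> uses time derivatives of order below
  \<open>j\<close> only, so the orders \<open>i < m\<close> cover all \<open>j \<le> m\<close>.
  Working entrywise reduces the matrix product rule to the real one.\<close>

lemma hrk_D_has_derivative:
  fixes A :: "real \<Rightarrow> real \<Rightarrow> real^'m^'m"
  assumes "\<And>i r s. i < m \<Longrightarrow>
    ((\<lambda>x. time_deriv T i (A x) t $ r $ s) has_real_derivative B i $ r $ s) (at x)"
    and "j \<le> m"
  shows "((\<lambda>x. hrk_D T (A x) t j $ r $ s) has_real_derivative
    hrk_D_variation T (A x) t B j $ r $ s) (at x)"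
  using assms(2)
proof (induction j arbitrary: r s rule: less_induct)
  case (less j)
  show ?case
  proof (cases j)
    case (Suc k)
    have "((\<lambda>x. \<Sum>l\<le>k. real (k choose l) *
        (\<Sum>u\<in>UNIV. time_deriv T (k - l) (A x) t $ r $ u * hrk_D T (A x) t l $ u $ s))
      has_real_derivative (\<Sum>l\<le>k. real (k choose l) *
        (\<Sum>u\<in>UNIV. B (k - l) $ r $ u * hrk_D T (A x) t l $ u $ s +
           hrk_D_variation T (A x) t B l $ u $ s * time_deriv T (k - l) (A x) t $ r $ u))) (at x)"
      using less Suc assms(1)
      by (intro DERIV_sum DERIV_cmult DERIV_mult) auto
    then show ?thesis
      by (simp add: Suc matrix_matrix_mult_def sum.distrib mult.commute)
  qed simp
qed

text \<open>With \<open>S i\<close> the \<open>i\<close>-th time derivative of a smooth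
  \<open>A\<close>, this is the \<open>j\<close>-th time derivative of the solution of w' = A w
  through \<open>x\<close>. It needs only products of matrices with vectors.\<close>

fun taylor_vec :: "(nat \<Rightarrow> real^'m^'m) \<Rightarrow> real^'m \<Rightarrow> nat \<Rightarrow> real^'m" where
  "taylor_vec S x 0 = x"
| "taylor_vec S x (Suc j) = (\<Sum>l\<le>j. real (j choose l) *\<^sub>R (S (j - l) *v taylor_vec S x l))"

text \<open>The directional derivative of \<^const>\<open>taylor_vec\<close> when \<open>S i\<close> alone is moved in direction \<open>X\<close>.\<close>

fun taylor_variation ::
  "(nat \<Rightarrow> real^'m^'m) \<Rightarrow> real^'m^'m \<Rightarrow> nat \<Rightarrow> real^'m \<Rightarrow> nat \<Rightarrow> real^'m" where
  "taylor_variation S X i x 0 = 0"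
| "taylor_variation S X i x (Suc j) = (\<Sum>l\<le>j. real (j choose l) *\<^sub>R
     ((if i = j - l then X *v taylor_vec S x l else 0) + S (j - l) *v taylor_variation S X i x l))"

lemma matrix_vector_mult_sum_left:
  "(\<Sum>i\<in>I. f i) *v x = (\<Sum>i\<in>I. f i *v x)" for x :: "real^'m" and f :: "'i \<Rightarrow> real^'m^'m"
  by (induction I rule: infinite_finite_induct) (auto simp: matrix_vector_mult_add_rdistrib)

lemma matrix_vector_mult_sum_right:
  "X *v (\<Sum>i\<in>I. f i) = (\<Sum>i\<in>I. X *v f i)" for X :: "real^'m^'m"
  by (induction I rule: infinite_finite_induct) (auto simp: matrix_vector_right_distrib)

lemma hrk_D_vec: "hrk_D T A t j *v x = taylor_vec (\<lambda>i. time_deriv T i A t) x j"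
proof (induction j rule: less_induct)
  case (less j)
  then show ?case
    by (cases j) (auto simp: matrix_vector_mult_sum_left scaleR_matrix_vector_assoc[symmetric]
        matrix_vector_mul_assoc[symmetric] intro!: sum.cong)
qed

text \<open>The variation is linear in the direction \<open>B\<close>, so it splits over the control
  matrix and the order \<open>i\<close> in which it acts. The scalars \<open>g\<close> come out in
  front of vectors that do not involve them.\<close>

lemma hrk_D_variation_vec:
  fixes Ac :: "nat \<Rightarrow> real^'m^'m"
  assumes "j \<le> m"
  shows "hrk_D_variation T A t (\<lambda>i. \<Sum>c\<in>C. g c i *\<^sub>R Ac c) j *v x =
    (\<Sum>c\<in>C. \<Sum>i<m. g c i *\<^sub>R taylor_variation (\<lambda>i. time_deriv T i A t) (Ac c) i x j)"
  using assms
proof (induction j rule: less_induct)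
  case (less j)
  let ?S = "\<lambda>i. time_deriv T i A t"
  show ?case
  proof (cases j)
    case (Suc k)
    have "(\<Sum>c\<in>C. \<Sum>i<m. g c i *\<^sub>R taylor_variation ?S (Ac c) i x j) =
      (\<Sum>c\<in>C. \<Sum>i<m. \<Sum>l\<le>k. real (k choose l) *\<^sub>R
        (g c i *\<^sub>R ((if i = k - l then Ac c *v taylor_vec ?S x l else 0) +
          ?S (k - l) *v taylor_variation ?S (Ac c) i x l)))"
      by (simp add: Suc scaleR_sum_right mult.commute)
    also have "\<dots> = (\<Sum>c\<in>C. \<Sum>l\<le>k. \<Sum>i<m. real (k choose l) *\<^sub>R
        (g c i *\<^sub>R ((if i = k - l then Ac c *v taylor_vec ?S x l else 0) +
          ?S (k - l) *v taylor_variation ?S (Ac c) i x l)))"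
      by (intro sum.cong refl sum.swap)
    also have "\<dots> = (\<Sum>l\<le>k. \<Sum>c\<in>C. \<Sum>i<m. real (k choose l) *\<^sub>R
        (g c i *\<^sub>R ((if i = k - l then Ac c *v taylor_vec ?S x l else 0) +
          ?S (k - l) *v taylor_variation ?S (Ac c) i x l)))"
      by (rule sum.swap)
    also have "\<dots> = (\<Sum>l\<le>k. real (k choose l) *\<^sub>R
        ((\<Sum>c\<in>C. g c (k - l) *\<^sub>R (Ac c *v taylor_vec ?S x l)) +
          ?S (k - l) *v (\<Sum>c\<in>C. \<Sum>i<m. g c i *\<^sub>R taylor_variation ?S (Ac c) i x l)))"
    proof (intro sum.cong refl)
      fix l assume "l \<in> {..k}"
      \<comment> \<open>Since \<open>k - l \<le> k < j \<le> m\<close>, the one order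
        \<open>i = k - l\<close> at which the conditional is nonzero lies in the range of the
        sum.\<close>
      then have "k - l < m" using less.prems Suc by auto
      then have "(\<Sum>i<m. g c i *\<^sub>R (if i = k - l then Ac c *v taylor_vec ?S x l else 0)) =
          g c (k - l) *\<^sub>R (Ac c *v taylor_vec ?S x l)" for c
        by (simp add: if_distrib[of "scaleR _"] sum.delta cong: if_cong)
      then show "(\<Sum>c\<in>C. \<Sum>i<m. real (k choose l) *\<^sub>R
        (g c i *\<^sub>R ((if i = k - l then Ac c *v taylor_vec ?S x l else 0) +
          ?S (k - l) *v taylor_variation ?S (Ac c) i x l))) = real (k choose l) *\<^sub>R
        ((\<Sum>c\<in>C. g c (k - l) *\<^sub>R (Ac c *v taylor_vec ?S x l)) +
          ?S (k - l) *v (\<Sum>c\<in>C. \<Sum>i<m. g c i *\<^sub>R taylor_variation ?S (Ac c) i x l))"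
        by (simp only: scaleR_sum_right[symmetric] scaleR_add_right sum.distrib
            matrix_vector_mult_sum_right matrix_vector_mult_scaleR)
    qed
    also have "\<dots> = hrk_D_variation T A t (\<lambda>i. \<Sum>c\<in>C. g c i *\<^sub>R Ac c) j *v x"
      using less Suc
      by (auto simp: matrix_vector_mult_sum_left scaleR_matrix_vector_assoc[symmetric] hrk_D_vec
          matrix_vector_mul_assoc[symmetric] matrix_vector_mult_add_rdistrib intro!: sum.cong)
    finally show ?thesis by simp
  qed simp
qed

text \<open>\<open>hrk_L\<close> and \<open>hrk_R\<close> are both combinations of the matrices
  \<open>hrk_D\<close> with coefficients \<open>a j\<close> free of parameters, so this one formula
  serves both. Summing over \<open>j\<close> innermost leaves a single vector per pair of control
  matrix and order.\<close>

lemma matrix_pderiv_hrk_D_sum: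
  fixes A :: "('k \<Rightarrow> real) \<Rightarrow> real \<Rightarrow> real^'m^'m" and Ac :: "nat \<Rightarrow> real^'m^'m"
  assumes A: "\<And>i r s. i < m \<Longrightarrow> ((\<lambda>x. time_deriv T i (A (\<theta>(\<kappa> := x))) t $ r $ s) has_real_derivative
      (\<Sum>c\<in>C. g c i *\<^sub>R Ac c) $ r $ s) (at (\<theta> \<kappa>))"
    and J: "\<And>j. j \<in> J \<Longrightarrow> j \<le> m"
  shows "matrix_pderiv (\<lambda>\<theta>'. \<Sum>j\<in>J. a j *\<^sub>R hrk_D T (A \<theta>') t j) \<theta> \<kappa> *v x =
    (\<Sum>c\<in>C. \<Sum>i<m. g c i *\<^sub>R (\<Sum>j\<in>J. a j *\<^sub>R
      taylor_variation (\<lambda>i. time_deriv T i (A \<theta>) t) (Ac c) i x j))"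
proof -
  let ?D = "\<lambda>j. hrk_D_variation T (A \<theta>) t (\<lambda>i. \<Sum>c\<in>C. g c i *\<^sub>R Ac c) j"
  let ?V = "\<lambda>c i j. taylor_variation (\<lambda>i. time_deriv T i (A \<theta>) t) (Ac c) i x j"
  have "((\<lambda>x. hrk_D T (A (\<theta>(\<kappa> := x))) t j $ r $ s) has_real_derivative ?D j $ r $ s) (at (\<theta> \<kappa>))"
    if "j \<in> J" for j r s
    using hrk_D_has_derivative[where A = "\<lambda>x. A (\<theta>(\<kappa> := x))", OF A J[OF that]] by simp
  then have "((\<lambda>x. \<Sum>j\<in>J. a j * hrk_D T (A (\<theta>(\<kappa> := x))) t j $ r $ s) has_real_derivative
      (\<Sum>j\<in>J. a j * ?D j $ r $ s)) (at (\<theta> \<kappa>))" for r s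
    by (intro DERIV_sum DERIV_cmult)
  then have "matrix_pderiv (\<lambda>\<theta>'. \<Sum>j\<in>J. a j *\<^sub>R hrk_D T (A \<theta>') t j) \<theta> \<kappa> = (\<Sum>j\<in>J. a j *\<^sub>R ?D j)"
    by (intro matrix_pderiv_eqI) simp
  then have "matrix_pderiv (\<lambda>\<theta>'. \<Sum>j\<in>J. a j *\<^sub>R hrk_D T (A \<theta>') t j) \<theta> \<kappa> *v x =
      (\<Sum>j\<in>J. a j *\<^sub>R (\<Sum>c\<in>C. \<Sum>i<m. g c i *\<^sub>R ?V c i j))"
    using J by (auto simp: matrix_vector_mult_sum_left scaleR_matrix_vector_assoc[symmetric]
        hrk_D_variation_vec intro!: sum.cong)
  also have "\<dots> = (\<Sum>j\<in>J. \<Sum>c\<in>C. \<Sum>i<m. g c i *\<^sub>R a j *\<^sub>R ?V c i j)"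
    by (simp add: scaleR_sum_right mult.commute)
  also have "\<dots> = (\<Sum>c\<in>C. \<Sum>j\<in>J. \<Sum>i<m. g c i *\<^sub>R a j *\<^sub>R ?V c i j)"
    by (rule sum.swap)
  also have "\<dots> = (\<Sum>c\<in>C. \<Sum>i<m. \<Sum>j\<in>J. g c i *\<^sub>R a j *\<^sub>R ?V c i j)"
    by (intro sum.cong refl sum.swap)
  finally show ?thesis by (simp add: scaleR_sum_right)
qed

section \<open>Programs\<close>

text \<open>
  Scalar register \<open>0\<close> is not an output and serves as scratch space.  Validity is demanded for zero
  parameters, so that neither the program nor its cost can depend on the number of parameters.
\<close>

definition vec_computable ::
  "nat \<Rightarrow> nat \<Rightarrow> nat \<Rightarrow> nat \<Rightarrow> (('m::finite) inputs \<Rightarrow> real^'m) \<Rightarrow> bool" where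
  "vec_computable p q NT NC F \<longleftrightarrow> (\<forall>d. \<exists>P. valid_program p q NT NC 0 P \<and>
     (\<forall>D s v. \<exists>s' v'. fold (exec_instr D) P (s, v) = (s', v') \<and> v' d = F D \<and>
        (\<forall>r<d. v' r = v r) \<and> (\<forall>r>0. s' r = s r)))"

text \<open>Most closure properties reduce to a short suffix \<open>Q d\<close> that reworks the
  result in register \<open>d\<close>. The conditions on untouched registers compose, because both
  programs respect them.\<close>

lemma vec_computable_extend:
  assumes "vec_computable p q NT NC F" "\<And>d. valid_program p q NT NC 0 (Q d)"
    and Q: "\<And>d D s v. v d = F D \<Longrightarrow> \<exists>s' v'. fold (exec_instr D) (Q d) (s, v) = (s', v') \<and>
      v' d = G D \<and> (\<forall>r<d. v' r = v r) \<and> (\<forall>r>0. s' r = s r)"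
  shows "vec_computable p q NT NC G"
  unfolding vec_computable_def
proof
  fix d
  obtain P where P: "valid_program p q NT NC 0 P"
    "\<forall>D s v. \<exists>s' v'. fold (exec_instr D) P (s, v) = (s', v') \<and> v' d = F D \<and>
        (\<forall>r<d. v' r = v r) \<and> (\<forall>r>0. s' r = s r)"
    using assms(1) unfolding vec_computable_def by blast
  show "\<exists>P. valid_program p q NT NC 0 P \<and>
     (\<forall>D s v. \<exists>s' v'. fold (exec_instr D) P (s, v) = (s', v') \<and> v' d = G D \<and>
        (\<forall>r<d. v' r = v r) \<and> (\<forall>r>0. s' r = s r))"
  proof (intro exI[of _ "P @ Q d"] conjI allI)
    show "valid_program p q NT NC 0 (P @ Q d)"
      using P(1) assms(2)[of d] by (auto simp: valid_program_def)
    fix D s v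
    obtain s1 v1 where 1: "fold (exec_instr D) P (s, v) = (s1, v1)" "v1 d = F D"
      "\<forall>r<d. v1 r = v r" "\<forall>r>0. s1 r = s r"
      using P(2) by blast
    from Q[of v1 d D s1, OF 1(2)] 1 show "\<exists>s' v'. fold (exec_instr D) (P @ Q d) (s, v) = (s', v') \<and>
        v' d = G D \<and> (\<forall>r<d. v' r = v r) \<and> (\<forall>r>0. s' r = s r)"
      by auto
  qed
qed

section \<open>Basic closure properties of computable vectors\<close>

lemma vec_computable_zero: "vec_computable p q NT NC (\<lambda>D. 0)"
  unfolding vec_computable_def
proof
  fix d
  show "\<exists>P. valid_program p q NT NC 0 P \<and>
     (\<forall>D s v. \<exists>s' v'. fold (exec_instr D) P (s, v) = (s', v') \<and> v' d = 0 \<and>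
        (\<forall>r<d. v' r = v r) \<and> (\<forall>r>0. s' r = s r))"
    \<comment> \<open>The initial register contents are arbitrary, so zero is produced by scaling
      whatever \<open>d\<close> holds by 0.\<close>
    by (rule exI[of _ "[Load_Const 0 0, Vec_Scale d 0 d]"]) (simp add: valid_program_def)
qed

lemma vec_computable_state: "n \<le> NT \<Longrightarrow> vec_computable p q NT NC (\<lambda>D. in_state D n)"
  by (rule vec_computable_extend[OF vec_computable_zero, of _ _ _ _ "\<lambda>d. [Load_State d n]"])
    (auto simp: valid_program_def)

lemma vec_computable_scaleR:
  "vec_computable p q NT NC F \<Longrightarrow> vec_computable p q NT NC (\<lambda>D. a *\<^sub>R F D)"
  by (erule vec_computable_extend[of _ _ _ _ _ "\<lambda>d. [Load_Const 0 a, Vec_Scale d 0 d]"])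
    (auto simp: valid_program_def)

text \<open>The step size is an input and not a program constant, hence \<open>j\<close> successive
  scalings by the loaded value.\<close>

lemma vec_computable_scaleR_step:
  "vec_computable p q NT NC F \<Longrightarrow> vec_computable p q NT NC (\<lambda>D. in_step D ^ j *\<^sub>R F D)"
proof (induction j)
  case (Suc j)
  show ?case
    by (rule vec_computable_extend[OF Suc.IH[OF Suc.prems], of "\<lambda>d. [Load_Step 0, Vec_Scale d 0 d]"])
      (auto simp: valid_program_def)
qed simp

lemma vec_computable_mat_vec:
  "vec_computable p q NT NC F \<Longrightarrow> valid_matrix_ref p q NT NC 0 X \<Longrightarrow>
    vec_computable p q NT NC (\<lambda>D. in_matrix D X *v F D)"
  by (erule vec_computable_extend[of _ _ _ _ _ "\<lambda>d. [Mat_Vec d X d]"])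
    (auto simp: valid_program_def)

text \<open>The second summand is built in register \<open>Suc d\<close>; its program leaves all
  lower registers alone, so the first summand survives in \<open>d\<close>.\<close>

lemma vec_computable_add:
  assumes "vec_computable p q NT NC F" "vec_computable p q NT NC G"
  shows "vec_computable p q NT NC (\<lambda>D. F D + G D)"
proof -
  have "\<forall>d. \<exists>Q. valid_program p q NT NC 0 Q \<and> (\<forall>D s v. v d = F D \<longrightarrow>
      (\<exists>s' v'. fold (exec_instr D) Q (s, v) = (s', v') \<and> v' d = F D + G D \<and>
        (\<forall>r<d. v' r = v r) \<and> (\<forall>r>0. s' r = s r)))"
  proof
    fix d
    obtain P where P: "valid_program p q NT NC 0 P"
      "\<forall>D s v. \<exists>s' v'. fold (exec_instr D) P (s, v) = (s', v') \<and> v' (Suc d) = G D \<and>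
        (\<forall>r<Suc d. v' r = v r) \<and> (\<forall>r>0. s' r = s r)"
      using assms(2) unfolding vec_computable_def by blast
    show "\<exists>Q. valid_program p q NT NC 0 Q \<and> (\<forall>D s v. v d = F D \<longrightarrow>
      (\<exists>s' v'. fold (exec_instr D) Q (s, v) = (s', v') \<and> v' d = F D + G D \<and>
        (\<forall>r<d. v' r = v r) \<and> (\<forall>r>0. s' r = s r)))"
    proof (intro exI[of _ "P @ [Vec_Add d d (Suc d)]"] conjI allI impI)
      show "valid_program p q NT NC 0 (P @ [Vec_Add d d (Suc d)])"
        using P(1) by (auto simp: valid_program_def)
      fix D s v
      assume "v d = F D"
      moreover obtain s1 v1 where "fold (exec_instr D) P (s, v) = (s1, v1)" "v1 (Suc d) = G D"
        "\<forall>r<Suc d. v1 r = v r" "\<forall>r>0. s1 r = s r"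
        using P(2) by blast
      ultimately show "\<exists>s' v'. fold (exec_instr D) (P @ [Vec_Add d d (Suc d)]) (s, v) = (s', v') \<and>
          v' d = F D + G D \<and> (\<forall>r<d. v' r = v r) \<and> (\<forall>r>0. s' r = s r)"
        by simp
    qed
  qed
  from choice[OF this] obtain Q where Q: "\<forall>d. valid_program p q NT NC 0 (Q d) \<and>
      (\<forall>D s v. v d = F D \<longrightarrow> (\<exists>s' v'. fold (exec_instr D) (Q d) (s, v) = (s', v') \<and>
        v' d = F D + G D \<and> (\<forall>r<d. v' r = v r) \<and> (\<forall>r>0. s' r = s r)))"
    by (rule exE)
  show ?thesis
    by (rule vec_computable_extend[OF assms(1), of Q]) (use Q in simp_all)
qed

lemma vec_computable_sum:
  "(\<And>i. i \<in> I \<Longrightarrow> vec_computable p q NT NC (F i)) \<Longrightarrow>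
    vec_computable p q NT NC (\<lambda>D. \<Sum>i\<in>I. F i D)"
  by (induction I rule: infinite_finite_induct) (auto intro: vec_computable_zero vec_computable_add)

text \<open>The recursion is unrolled and lower vectors are recomputed at every use. This is
  wasteful, but the number of products stays fixed because no parameter index enters.\<close>

lemma vec_computable_taylor_vec:
  assumes "n \<le> NT" "j \<le> max p q"
  shows "vec_computable p q NT NC
    (\<lambda>D. taylor_vec (\<lambda>i. in_matrix D (Sys_Deriv i n)) (in_state D n) j)"
  using assms(2)
proof (induction j rule: less_induct)
  case (less j)
  show ?case
  proof (cases j)
    case (Suc k)
    then have "k < max p q"
      using less.prems by simp
    then show ?thesis
      unfolding Suc taylor_vec.simps
      by (intro vec_computable_sum vec_computable_scaleR vec_computable_mat_vec less.IH)
        (simp_all add: Suc assms(1) less_imp_diff_less del: less_max_iff_disj)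
  qed (simp add: vec_computable_state assms)
qed

lemma vec_computable_taylor_variation:
  assumes "n \<le> NT" "c \<in> {1..NC}" "j \<le> max p q"
  shows "vec_computable p q NT NC (\<lambda>D. taylor_variation
    (\<lambda>i. in_matrix D (Sys_Deriv i n)) (in_matrix D (Control c)) i (in_state D n) j)"
  using assms(3)
proof (induction j rule: less_induct)
  case (less j)
  show ?case
  proof (cases j)
    case (Suc k)
    then have k: "k < max p q"
      using less.prems by simp
    have "vec_computable p q NT NC (\<lambda>D. if i = k - l then in_matrix D (Control c) *v
        taylor_vec (\<lambda>i. in_matrix D (Sys_Deriv i n)) (in_state D n) l else 0)" if "l \<le> k" for l
    \<comment> \<open>The condition does not involve the inputs, so it is decided while the program
      is built; programs themselves cannot branch.\<close>
    proof (cases "i = k - l")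
      case True
      have "vec_computable p q NT NC (\<lambda>D. in_matrix D (Control c) *v
          taylor_vec (\<lambda>i. in_matrix D (Sys_Deriv i n)) (in_state D n) l)"
        using that k assms by (intro vec_computable_mat_vec vec_computable_taylor_vec) auto
      with True show ?thesis by simp
    qed (simp add: vec_computable_zero)
    with k show ?thesis
      unfolding Suc taylor_variation.simps
      by (intro vec_computable_sum vec_computable_scaleR vec_computable_add vec_computable_mat_vec less.IH)
        (simp_all add: Suc assms(1) less_imp_diff_less del: less_max_iff_disj)
  qed (simp add: vec_computable_zero)
qed

section \<open>Assembling the outputs for all parameters\<close>

lemma valid_program_mono: "valid_program p q NT NC 0 P \<Longrightarrow> valid_program p q NT NC NP P"
proof -
  have "valid_matrix_ref p q NT NC 0 X \<Longrightarrow> valid_matrix_ref p q NT NC NP X" for X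
    by (cases X) auto
  then have "valid_instr p q NT NC 0 I \<Longrightarrow> valid_instr p q NT NC NP I" for I
    by (cases I) auto
  then show "valid_program p q NT NC 0 P \<Longrightarrow> valid_program p q NT NC NP P"
    by (auto simp: valid_program_def)
qed

text \<open>One precomputed vector in register 0 serves every parameter: each induction step on
  \<open>K\<close> updates one further output by free instructions and keeps that vector
  intact.\<close>

lemma accumulate_term_program:
  assumes "c \<in> {1..NC}" "i < max p q" "n \<le> NT" "n' \<in> {1..NT}" "K \<le> NP"
  shows "\<exists>P. valid_program p q NT NC NP P \<and> matvec_count P = 0 \<and>
    (\<forall>(D :: ('m::finite) inputs) s v. \<exists>s' v'. fold (exec_instr D) P (s, v) = (s', v') \<and> v' 0 = v 0 \<and>
      (\<forall>k>0. s' k = s k + (if k \<le> K then in_pulse_deriv D c i n k * (v 0 \<bullet> in_adjoint D n') else 0)))"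
  using assms(5)
proof (induction K)
  case 0
  show ?case
    by (rule exI[of _ "[]"]) (auto simp: valid_program_def matvec_count_def)
next
  case (Suc K)
  then obtain P where P: "valid_program p q NT NC NP P" "matvec_count P = 0"
    "\<And>(D :: 'm inputs) s v. \<exists>s' v'. fold (exec_instr D) P (s, v) = (s', v') \<and> v' 0 = v 0 \<and>
      (\<forall>k>0. s' k = s k + (if k \<le> K then in_pulse_deriv D c i n k * (v 0 \<bullet> in_adjoint D n') else 0))"
    by auto
  \<comment> \<open>Only scalar register 0 is scratch, so the loaded factor is first moved into a
    scaled copy of the vector; the inner product may then overwrite it. Bilinearity gives the same
    value.\<close>
  let ?Q = "[Load_Pulse_Deriv 0 c i n (Suc K), Vec_Scale 1 0 0, Load_Adjoint 2 n', Inner_Prod 0 1 2,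
    Scalar_Add (Suc K) (Suc K) 0]"
  show ?case
  proof (intro exI[of _ "P @ ?Q"] conjI allI)
    show "valid_program p q NT NC NP (P @ ?Q)"
      using P(1) assms Suc.prems by (auto simp: valid_program_def)
    show "matvec_count (P @ ?Q) = 0"
      using P(2) by (simp add: matvec_count_def)
    fix D :: "'m inputs" and s v
    obtain s1 v1 where "fold (exec_instr D) P (s, v) = (s1, v1)" "v1 0 = v 0"
      "\<forall>k>0. s1 k = s k + (if k \<le> K then in_pulse_deriv D c i n k * (v 0 \<bullet> in_adjoint D n') else 0)"
      using P(3) by blast
    then show "\<exists>s' v'. fold (exec_instr D) (P @ ?Q) (s, v) = (s', v') \<and> v' 0 = v 0 \<and>
      (\<forall>k>0. s' k = s k +
        (if k \<le> Suc K then in_pulse_deriv D c i n k * (v 0 \<bullet> in_adjoint D n') else 0))"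
      by (auto simp: le_Suc_eq)
  qed
qed

text \<open>Induction on the set of terms: each term pays once for its vector \<open>F x D\<close>
  and then updates all outputs without matrix products. Hence the bound is a sum over
  \<open>I\<close> and can be fixed before \<open>NP\<close>.\<close>

lemma accumulation_program:
  fixes F :: "'i \<Rightarrow> ('m::finite) inputs \<Rightarrow> real^'m"
  assumes "finite I"
    and "\<And>x. x \<in> I \<Longrightarrow> vec_computable p q NT NC (F x) \<and> c x \<in> {1..NC} \<and> i x < max p q \<and>
      n x \<le> NT \<and> n' x \<in> {1..NT}"
  shows "\<exists>M. \<forall>NP. \<exists>P. valid_program p q NT NC NP P \<and> matvec_count P \<le> M \<and>
    (\<forall>D. \<forall>k\<in>{1..NP}. program_output D P k =
      (\<Sum>x\<in>I. in_pulse_deriv D (c x) (i x) (n x) k * (F x D \<bullet> in_adjoint D (n' x))))"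
  using assms
proof (induction I rule: finite_induct)
  case empty
  show ?case
    by (intro exI[of _ 0] allI exI[of _ "[]"])
      (auto simp: valid_program_def matvec_count_def program_output_def run_def)
next
  case (insert x I)
  let ?out = "\<lambda>I (D :: 'm inputs) k. \<Sum>x\<in>I. in_pulse_deriv D (c x) (i x) (n x) k * (F x D \<bullet> in_adjoint D (n' x))"
  obtain M where M: "\<And>NP. \<exists>P. valid_program p q NT NC NP P \<and> matvec_count P \<le> M \<and>
    (\<forall>D :: 'm inputs. \<forall>k\<in>{1..NP}. program_output D P k = ?out I D k)"
    using insert by auto
  obtain Q where Q: "valid_program p q NT NC 0 Q"
    "\<forall>(D :: 'm inputs) s v. \<exists>s' v'. fold (exec_instr D) Q (s, v) = (s', v') \<and> v' 0 = F x D \<and>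
        (\<forall>r<0. v' r = v r) \<and> (\<forall>r>0. s' r = s r)"
    using insert.prems[of x] unfolding vec_computable_def by blast
  show ?case
  \<comment> \<open>\<open>Q\<close> was obtained for zero parameters, before \<open>NP\<close> is
    introduced, so its cost may enter the bound.\<close>
  proof (intro exI[of _ "M + matvec_count Q"] allI)
    fix NP
    obtain P where P: "valid_program p q NT NC NP P" "matvec_count P \<le> M"
      "\<And>(D :: 'm inputs) k. k \<in> {1..NP} \<Longrightarrow> program_output D P k = ?out I D k"
      using M by blast
    obtain R where R: "valid_program p q NT NC NP R" "matvec_count R = 0"
      "\<And>(D :: 'm inputs) s v. \<exists>s' v'. fold (exec_instr D) R (s, v) = (s', v') \<and> v' 0 = v 0 \<and>
      (\<forall>k>0. s' k = s k + (if k \<le> NP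
        then in_pulse_deriv D (c x) (i x) (n x) k * (v 0 \<bullet> in_adjoint D (n' x)) else 0))"
      using accumulate_term_program[of "c x" NC "i x" p q "n x" NT "n' x" NP NP] insert.prems[of x] by auto
    show "\<exists>P. valid_program p q NT NC NP P \<and> matvec_count P \<le> M + matvec_count Q \<and>
      (\<forall>D. \<forall>k\<in>{1..NP}. program_output D P k = ?out (insert x I) D k)"
    \<comment> \<open>\<open>P\<close> leaves the partial sums in the output registers,
      \<open>Q\<close> puts the new vector into vector register 0 without touching them, and
      \<open>R\<close> adds the new term to each.\<close>
    proof (intro exI[of _ "P @ Q @ R"] conjI allI ballI)
      show "valid_program p q NT NC NP (P @ Q @ R)"
        using P(1) R(1) valid_program_mono[OF Q(1), of NP] by (auto simp: valid_program_def)
      show "matvec_count (P @ Q @ R) \<le> M + matvec_count Q"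
        using P(2) R(2) by (simp add: matvec_count_def)
      fix D :: "'m inputs" and k assume k: "k \<in> {1..NP}"
      obtain s v where 1: "run D P = (s, v)" by fastforce
      obtain s1 v1 where 2: "fold (exec_instr D) Q (s, v) = (s1, v1)" "v1 0 = F x D" "\<forall>r>0. s1 r = s r"
        using Q(2) by blast
      obtain s2 v2 where 3: "fold (exec_instr D) R (s1, v1) = (s2, v2)"
        "\<forall>k>0. s2 k = s1 k + (if k \<le> NP
          then in_pulse_deriv D (c x) (i x) (n x) k * (v1 0 \<bullet> in_adjoint D (n' x)) else 0)"
        using R(3) by blast
      show "program_output D (P @ Q @ R) k = ?out (insert x I) D k"
        using P(3)[OF k, of D] 1 2 3 k insert.hyps by (simp add: program_output_def run_def)
    qed
  qed
qed

section \<open>The gradient accumulation\<close>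

text \<open>
  \<open>b\<close> selects the matrix: \<open>L\<^sub>n\<^sub>+\<^sub>1\<^sub>,\<^sub>q\<close> for true, \<open>R\<^sub>n\<^sub>,\<^sub>p\<close> for false.
\<close>

definition hrk_weight :: "nat \<Rightarrow> nat \<Rightarrow> bool \<Rightarrow> nat \<Rightarrow> real" where
  "hrk_weight p q b j =
    (if b then - ((-1) ^ j * hrk_coeff q p j * (1 / fact j)) else hrk_coeff p q j * (1 / fact j))"

text \<open>The overall minus sign of the gradient formula is absorbed into the weight. The power of
  the step size stays a separate factor because it is known only from the inputs.\<close>

definition gradient_vec ::
  "nat \<Rightarrow> nat \<Rightarrow> bool \<Rightarrow> nat \<Rightarrow> nat \<Rightarrow> nat \<Rightarrow> ('m::finite) inputs \<Rightarrow> real^'m" where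
  "gradient_vec p q b n c i D = (\<Sum>j=1..(if b then q else p). (- hrk_weight p q b j) *\<^sub>R in_step D ^ j *\<^sub>R
     taylor_variation (\<lambda>l. in_matrix D (Sys_Deriv l n)) (in_matrix D (Control c)) i (in_state D n) j)"

lemma vec_computable_gradient_vec:
  "n \<le> NT \<Longrightarrow> c \<in> {1..NC} \<Longrightarrow> vec_computable p q NT NC (gradient_vec p q b n c i)"
  unfolding gradient_vec_def[abs_def]
  by (intro vec_computable_sum vec_computable_scaleR vec_computable_scaleR_step
      vec_computable_taylor_variation) (auto split: if_splits)

lemma gradient_accumulation_eq:
  fixes Ad :: "real^'m^'m" and Ac :: "nat \<Rightarrow> real^'m^'m" and \<theta> :: "nat \<times> nat \<Rightarrow> real"
    and w lam :: "nat \<Rightarrow> real^'m" and e :: "nat \<Rightarrow> nat \<times> nat"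
  assumes T: "T > 0" and "NT \<ge> 1" "p + q \<ge> 1"
    and c: "\<And>j k. j \<in> {1..NC} \<Longrightarrow> k \<in> {1..nj j} \<Longrightarrow> times_differentiable T (max p q - 1) (c j k)"
  defines "D \<equiv> control_inputs T NT NC nj e Ad Ac c \<theta> w lam"
  shows "gradient_accumulation p q T NT (system_matrix NC nj Ad Ac c) \<theta> w lam (e k) =
    (\<Sum>n=0..NT - 1. \<Sum>b\<in>UNIV. \<Sum>j=1..NC. \<Sum>i<max p q. in_pulse_deriv D j i (n + of_bool b) k *
      (gradient_vec p q b (n + of_bool b) j i D \<bullet> in_adjoint D (n + 1)))"
proof -
  let ?A = "system_matrix NC nj Ad Ac c" and ?t = "grid_time T NT"
  have deriv: "(matrix_pderiv (\<lambda>\<theta>'. \<Sum>j=1..(if b then q else p).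
        (hrk_weight p q b j * time_step T NT ^ j) *\<^sub>R hrk_D T (?A \<theta>') (?t n) j) \<theta> (e k) *v w n) =
      - (\<Sum>j=1..NC. \<Sum>i<max p q. in_pulse_deriv D j i n k *\<^sub>R gradient_vec p q b n j i D)"
    if "n \<le> NT" for b n
  proof -
    have t: "?t n \<in> {0..T}"
      using that T assms(2) by (auto simp: grid_time_def time_step_def field_simps)
    show ?thesis
      \<comment> \<open>Both \<open>p\<close> and \<open>q\<close> are at most
        \<open>max p q\<close>, so orders \<open>i < max p q\<close> suffice; these are the orders
        \<open>i \<le> max p q - 1\<close> covered by the smoothness assumption.\<close>
      by (subst matrix_pderiv_hrk_D_sum[where m = "max p q" and C = "{1..NC}" and Ac = Ac,
            OF system_matrix_param_deriv[where m = "max p q - 1", OF T _ t c]])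
        (use assms(3) in \<open>auto simp: D_def control_inputs_def gradient_vec_def sum_negf split: if_splits\<close>)
  qed
  \<comment> \<open>The conditional on a constant is kept so that the right-hand side matches
    \<open>deriv\<close> literally when unfolded; likewise in \<open>R\<close>.\<close>
  have L: "hrk_L p q T NT (?A \<theta>') n = (\<Sum>j=1..(if True then q else p).
        (hrk_weight p q True j * time_step T NT ^ j) *\<^sub>R hrk_D T (?A \<theta>') (?t n) j)" for \<theta>' n
    by (simp add: hrk_L_def hrk_weight_def sum_negf)
  have R: "hrk_R p q T NT (?A \<theta>') n = (\<Sum>j=1..(if False then q else p).
        (hrk_weight p q False j * time_step T NT ^ j) *\<^sub>R hrk_D T (?A \<theta>') (?t n) j)" for \<theta>' n
    by (simp add: hrk_R_def hrk_weight_def)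
  show ?thesis
    unfolding gradient_accumulation_def sum_negf[symmetric]
  proof (intro sum.cong refl)
    fix n assume "n \<in> {0..NT - 1}"
    then have n: "n + 1 \<le> NT" "n \<le> NT" using assms(2) by auto
    show "- ((matrix_pderiv (\<lambda>\<theta>'. hrk_L p q T NT (?A \<theta>') (n + 1)) \<theta> (e k) *v w (n + 1) +
        matrix_pderiv (\<lambda>\<theta>'. hrk_R p q T NT (?A \<theta>') n) \<theta> (e k) *v w n) \<bullet> lam (n + 1)) =
      (\<Sum>b\<in>UNIV. \<Sum>j=1..NC. \<Sum>i<max p q. in_pulse_deriv D j i (n + of_bool b) k *
      (gradient_vec p q b (n + of_bool b) j i D \<bullet> in_adjoint D (n + 1)))"
      unfolding L R deriv[OF n(1)] deriv[OF n(2)]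
      by (simp add: UNIV_bool inner_diff_left inner_sum_left D_def control_inputs_def)
  qed
qed

text \<open>The order of quantifiers carries the claim: \<open>M\<close> precedes the number and
  distribution of parameters, and the program precedes all numerical data. The index type
  \<open>'n + 'n\<close> encodes the even dimension 2N.\<close>

theorem theorem2:
  fixes NT NC p q :: nat
  assumes "NT \<ge> 1" and "NC \<ge> 1" and "p + q \<ge> 1"
  shows "\<exists>M::nat. \<forall>(NP::nat) (nj :: nat \<Rightarrow> nat) (e :: nat \<Rightarrow> nat \<times> nat).
    NP \<ge> 1 \<longrightarrow> (\<Sum>j=1..NC. nj j) = NP \<longrightarrow>
    bij_betw e {1..NP} (SIGMA j:{1..NC}. {1..nj j}) \<longrightarrow>
    (\<exists>P. valid_program p q NT NC NP P \<and> matvec_count P \<le> M \<and>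
      (\<forall>(T::real) (Ad :: real^('n::finite + 'n)^('n + 'n)) (Ac :: nat \<Rightarrow> real^('n + 'n)^('n + 'n))
         (c :: nat \<Rightarrow> nat \<Rightarrow> real \<Rightarrow> real) (\<theta> :: nat \<times> nat \<Rightarrow> real)
         (w :: nat \<Rightarrow> real^('n + 'n)) (lam :: nat \<Rightarrow> real^('n + 'n)).
         T > 0 \<longrightarrow>
         (\<forall>j\<in>{1..NC}. \<forall>k\<in>{1..nj j}. times_differentiable T (max p q - 1) (c j k)) \<longrightarrow>
         (\<forall>k\<in>{1..NP}.
            program_output (control_inputs T NT NC nj e Ad Ac c \<theta> w lam) P k =
            gradient_accumulation p q T NT (system_matrix NC nj Ad Ac c) \<theta> w lam (e k))))"
proof -
  \<comment> \<open>One index per time step, choice of L or R, pulse and derivative order: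
    \<open>2 * NT * NC * max p q\<close> terms, a number free of \<open>NP\<close>. The shift
    \<open>of_bool b\<close> places L at the later grid point.\<close>
  let ?I = "{0..NT - 1} \<times> (UNIV :: bool set) \<times> {1..NC} \<times> {..<max p q}"
  let ?F = "\<lambda>(n, b, j, i). gradient_vec p q b (n + of_bool b) j i ::
    ('n + 'n) inputs \<Rightarrow> real^('n + 'n)"
  have "\<exists>M. \<forall>NP. \<exists>P. valid_program p q NT NC NP P \<and> matvec_count P \<le> M \<and>
    (\<forall>D. \<forall>k\<in>{1..NP}. program_output D P k = (\<Sum>x\<in>?I.
      in_pulse_deriv D ((\<lambda>(n, b, j, i). j) x) ((\<lambda>(n, b, j, i). i) x) ((\<lambda>(n, b, j, i). n + of_bool b) x) k *
      (?F x D \<bullet> in_adjoint D ((\<lambda>(n, b, j, i). n + 1) x))))"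
    using assms(1) by (intro accumulation_program) (auto simp: vec_computable_gradient_vec)
  then obtain M where M: "\<And>NP. \<exists>P. valid_program p q NT NC NP P \<and> matvec_count P \<le> M \<and>
    (\<forall>D. \<forall>k\<in>{1..NP}. program_output D P k = (\<Sum>n=0..NT - 1. \<Sum>b\<in>UNIV. \<Sum>j=1..NC. \<Sum>i<max p q.
      in_pulse_deriv D j i (n + of_bool b) k *
      (gradient_vec p q b (n + of_bool b) j i (D :: ('n + 'n) inputs) \<bullet> in_adjoint D (n + 1))))"
    by (simp add: sum.cartesian_product case_prod_unfold) blast
  show ?thesis
  proof (intro exI[of _ M] allI impI)
    fix NP and nj :: "nat \<Rightarrow> nat" and e :: "nat \<Rightarrow> nat \<times> nat"
    obtain P where P: "valid_program p q NT NC NP P" "matvec_count P \<le> M"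
      "\<And>k D. k \<in> {1..NP} \<Longrightarrow> program_output D P k =
        (\<Sum>n=0..NT - 1. \<Sum>b\<in>UNIV. \<Sum>j=1..NC. \<Sum>i<max p q. in_pulse_deriv D j i (n + of_bool b) k *
      (gradient_vec p q b (n + of_bool b) j i (D :: ('n + 'n) inputs) \<bullet> in_adjoint D (n + 1)))"
      using M by blast
    show "\<exists>P. valid_program p q NT NC NP P \<and> matvec_count P \<le> M \<and>
      (\<forall>(T::real) (Ad :: real^('n::finite + 'n)^('n + 'n)) (Ac :: nat \<Rightarrow> real^('n + 'n)^('n + 'n))
         (c :: nat \<Rightarrow> nat \<Rightarrow> real \<Rightarrow> real) (\<theta> :: nat \<times> nat \<Rightarrow> real)
         (w :: nat \<Rightarrow> real^('n + 'n)) (lam :: nat \<Rightarrow> real^('n + 'n)).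
         T > 0 \<longrightarrow>
         (\<forall>j\<in>{1..NC}. \<forall>k\<in>{1..nj j}. times_differentiable T (max p q - 1) (c j k)) \<longrightarrow>
         (\<forall>k\<in>{1..NP}.
            program_output (control_inputs T NT NC nj e Ad Ac c \<theta> w lam) P k =
            gradient_accumulation p q T NT (system_matrix NC nj Ad Ac c) \<theta> w lam (e k)))"
    proof (intro exI[of _ P] conjI allI impI ballI P(1,2))
      fix T :: real and Ad :: "real^('n + 'n)^('n + 'n)" and Ac :: "nat \<Rightarrow> real^('n + 'n)^('n + 'n)"
        and c :: "nat \<Rightarrow> nat \<Rightarrow> real \<Rightarrow> real" and \<theta> :: "nat \<times> nat \<Rightarrow> real"
        and w lam :: "nat \<Rightarrow> real^('n + 'n)" and k
      assume "T > 0" "k \<in> {1..NP}"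
        and "\<forall>j\<in>{1..NC}. \<forall>k\<in>{1..nj j}. times_differentiable T (max p q - 1) (c j k)"
      then show "program_output (control_inputs T NT NC nj e Ad Ac c \<theta> w lam) P k =
          gradient_accumulation p q T NT (system_matrix NC nj Ad Ac c) \<theta> w lam (e k)"
        by (subst gradient_accumulation_eq[OF _ assms(1,3)]) (blast intro: P(3))+
    qed
  qed
qed

end
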